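(* Let $E/\mathbf{Q}$ be an elliptic curve having two pairs of Galois-stable cyclic subgroups of order $4$. Then each cyclic subgroup of order $4$ in the remaining (third) pair of cyclic subgroups of order $4$ of $E$ is defined over $\mathbf{Q}(i)$, but not over $\mathbf{Q}$.
   Context: $E(\overline{\mathbf{Q}})$ has exactly six cyclic subgroups of order $4$; they are grouped into three pairs, two such subgroups being in the same pair when they contain the same subgroup of order $2$. A cyclic subgroup of order $4$ is defined over a field $K$ with $\mathbf{Q}\subseteq K\subset\overline{\mathbf{Q}}$ if it is mapped to itself by every element of $\mathrm{Gal}(\overline{\mathbf{Q}}/K)$; it is Galois-stable if it is defined over $\mathbf{Q}$. A pair of Galois-stable cyclic subgroups of order $4$ is a pair of distinct cyclic subgroups of order $4$ of $E$ that contain the same subgroup of order $2$ and each of which is Galois-stable. *)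

theory Defs
  imports "HOL-Algebra.Algebra" "HOL-Algebra.Algebraic_Closure_Type"
begin

section \<open>Weierstrass equations\<close>

text \<open>An elliptic curve over a field is given by a general Weierstrass equation
  \<open>y\<^sup>2 + a\<^sub>1xy + a\<^sub>3y = x\<^sup>3 + a\<^sub>2x\<^sup>2 + a\<^sub>4x + a\<^sub>6\<close> with non-zero discriminant.\<close>

datatype 'a weierstrass =
  Weierstrass (a\<^sub>1: 'a) (a\<^sub>2: 'a) (a\<^sub>3: 'a) (a\<^sub>4: 'a) (a\<^sub>6: 'a)

definition discriminant :: "'a::comm_ring_1 weierstrass \<Rightarrow> 'a" where
  "discriminant E =
    (let b2 = (a\<^sub>1 E)^2 + 4 * a\<^sub>2 E;
         b4 = 2 * a\<^sub>4 E + a\<^sub>1 E * a\<^sub>3 E;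
         b6 = (a\<^sub>3 E)^2 + 4 * a\<^sub>6 E;
         b8 = (a\<^sub>1 E)^2 * a\<^sub>6 E + 4 * a\<^sub>2 E * a\<^sub>6 E - a\<^sub>1 E * a\<^sub>3 E * a\<^sub>4 E
              + a\<^sub>2 E * (a\<^sub>3 E)^2 - (a\<^sub>4 E)^2
     in - (b2^2 * b8) - 8 * b4^3 - 27 * b6^2 + 9 * b2 * b4 * b6)"

definition elliptic_curve :: "'a::field weierstrass \<Rightarrow> bool" where
  "elliptic_curve E \<longleftrightarrow> discriminant E \<noteq> 0"

text \<open>\<open>Infinity\<close> is the unique point at infinity \<open>[0:1:0]\<close> of the projective closure.\<close>

datatype 'a point = Infinity | Affine 'a 'a

fun on_curve :: "'a::field weierstrass \<Rightarrow> 'a point \<Rightarrow> bool" where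
  "on_curve E Infinity \<longleftrightarrow> True"
| "on_curve E (Affine x y) \<longleftrightarrow>
     y^2 + a\<^sub>1 E * x * y + a\<^sub>3 E * y = x^3 + a\<^sub>2 E * x^2 + a\<^sub>4 E * x + a\<^sub>6 E"

text \<open>The chord-and-tangent law. In the affine case \<open>y = l * x + (y1 - l * x1)\<close> is the line through
  the two points (the tangent, if they coincide); its third intersection with the curve
  has first coordinate \<open>x3\<close>, and the sum is the negative of that third point, where the negative of
  \<open>(x, y)\<close> is \<open>(x, - y - a\<^sub>1x - a\<^sub>3)\<close>. The outer condition tests whether
  the two points are negatives of each other.\<close>

fun point_add :: "'a::field weierstrass \<Rightarrow> 'a point \<Rightarrow> 'a point \<Rightarrow> 'a point" where
  "point_add E Infinity Q = Q"
| "point_add E P Infinity = P"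
| "point_add E (Affine x1 y1) (Affine x2 y2) =
    (if x1 = x2 \<and> y1 + y2 + a\<^sub>1 E * x2 + a\<^sub>3 E = 0 then Infinity
     else
       let l = (if x1 = x2
                then (3 * x1^2 + 2 * a\<^sub>2 E * x1 + a\<^sub>4 E - a\<^sub>1 E * y1) / (2 * y1 + a\<^sub>1 E * x1 + a\<^sub>3 E)
                else (y2 - y1) / (x2 - x1));
           x3 = l^2 + a\<^sub>1 E * l - a\<^sub>2 E - x1 - x2;
           y3 = l * x3 + (y1 - l * x1)
       in Affine x3 (- y3 - a\<^sub>1 E * x3 - a\<^sub>3 E))"


section \<open>The algebraic closure of the rationals and its Galois groups\<close>

text \<open>The algebraic closure of \<open>\<rat>\<close> is realised as the field of algebraic complex numbers.\<close>

definition Qbar :: "complex ring" where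
  "Qbar = ring_of_type_algebra\<lparr>carrier := {z. algebraic z}\<rparr>"

text \<open>\<open>Gal K\<close> is \<open>Gal(Qbar/K)\<close>. Only the values of an element on \<open>carrier Qbar\<close>
  are meaningful.\<close>

definition Gal :: "complex set \<Rightarrow> (complex \<Rightarrow> complex) set" where
  "Gal K = {\<sigma> \<in> ring_iso Qbar Qbar. \<forall>x\<in>K. \<sigma> x = x}"

definition Q_i :: "complex set" where
  "Q_i = generate_field Qbar (insert \<i> \<rat>)"


section \<open>Cyclic subgroups of order 4\<close>

definition Qbar_points :: "rat weierstrass \<Rightarrow> complex point monoid" where
  "Qbar_points E =
    \<lparr>carrier = {P. on_curve (map_weierstrass of_rat E) P \<and> set_point P \<subseteq> carrier Qbar},
     monoid.mult = point_add (map_weierstrass of_rat E),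
     one = Infinity\<rparr>"

definition cyclic_subgroup4 :: "rat weierstrass \<Rightarrow> complex point set \<Rightarrow> bool" where
  "cyclic_subgroup4 E C \<longleftrightarrow>
     subgroup C (Qbar_points E) \<and> cyclic_group ((Qbar_points E)\<lparr>carrier := C\<rparr>) \<and> card C = 4"

definition defined_over :: "complex set \<Rightarrow> complex point set \<Rightarrow> bool" where
  "defined_over K C \<longleftrightarrow> (\<forall>\<sigma>\<in>Gal K. map_point \<sigma> ` C = C)"

definition galois_stable :: "complex point set \<Rightarrow> bool" where
  "galois_stable C \<longleftrightarrow> defined_over \<rat> C"

definition cyclic4_pair :: "rat weierstrass \<Rightarrow> complex point set set \<Rightarrow> bool" where
  "cyclic4_pair E p \<longleftrightarrow>
     (\<exists>C D. p = {C, D} \<and> C \<noteq> D \<and> cyclic_subgroup4 E C \<and> cyclic_subgroup4 E D \<and>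
        (\<exists>T. subgroup T (Qbar_points E) \<and> card T = 2 \<and> T \<subseteq> C \<and> T \<subseteq> D))"

definition galois_stable_pair :: "rat weierstrass \<Rightarrow> complex point set set \<Rightarrow> bool" where
  "galois_stable_pair E p \<longleftrightarrow> cyclic4_pair E p \<and> (\<forall>C\<in>p. galois_stable C)"

end

theory Submission
  imports Defs
begin

text \<open>Write \<open>\<psi>(x) = 4x\<^sup>3 + b\<^sub>2x\<^sup>2 + 2b\<^sub>4x + b\<^sub>6\<close>, which equals \<open>(2y + a\<^sub>1x + a\<^sub>3)\<^sup>2\<close> on the curve, so
that its roots \<open>e\<^sub>1, e\<^sub>2, e\<^sub>3\<close> are the first coordinates of the points of order \<open>2\<close>. A cyclic subgroup of
order \<open>4\<close> has the form \<open>{O, T, P, -P}\<close> with \<open>2P = T\<close> and \<open>2T = O\<close>; it is the set of all points whose first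
coordinate is \<open>e = x(T)\<close> or \<open>x = x(P)\<close>, together with \<open>O\<close>. The duplication formula gives
\<open>(x - e)\<^sup>2 = \<psi>'(e)/4\<close>. Hence the pair of subgroups above \<open>T\<close> corresponds to \<open>x = e + d\<close> and \<open>x = e - d\<close>, where
\<open>d\<^sup>2 = \<psi>'(e)/4\<close> and \<open>d \<noteq> 0\<close>, and the pair is determined by \<open>e\<close>. A field automorphism \<open>\<sigma>\<close> of \<open>Qbar\<close> maps
such a subgroup to itself if and only if it fixes \<open>e\<close> and \<open>x\<close>, that is, \<open>e\<close> and \<open>d\<close>: it
cannot interchange \<open>e\<close> and \<open>x\<close>, because \<open>\<psi>\<close> vanishes at only one of them
(\<open>defined_over_iff_fixes_coordinates\<close>, \<open>cyclic4_pair_coordinates\<close>).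

The three pairs therefore belong to the three distinct roots of \<open>\<psi>\<close>. Since
\<open>\<psi>'(e\<^sub>1)/4 = (e\<^sub>1 - e\<^sub>2)(e\<^sub>1 - e\<^sub>3)\<close>, and cyclically, the product of the three squares is
\<open>(d\<^sub>1d\<^sub>2d\<^sub>3)\<^sup>2 = -v\<^sup>2\<close> with \<open>v = (e\<^sub>1 - e\<^sub>2)(e\<^sub>1 - e\<^sub>3)(e\<^sub>2 - e\<^sub>3)\<close>, so \<open>d\<^sub>1d\<^sub>2d\<^sub>3\<close> is \<open>\<i>v\<close> or \<open>-\<i>v\<close>.
Stability of the first two pairs says that the absolute Galois group fixes \<open>e\<^sub>1, d\<^sub>1, e\<^sub>2, d\<^sub>2\<close>; it fixes
\<open>e\<^sub>3\<close> as well, because \<open>e\<^sub>1 + e\<^sub>2 + e\<^sub>3 = -b\<^sub>2/4\<close> is rational, and hence it fixes \<open>v\<close>. So an automorphism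
acts on \<open>d\<^sub>3\<close> exactly as it acts on \<open>\<i>\<close>: those that fix \<open>\<i>\<close> fix \<open>d\<^sub>3\<close>, and complex conjugation sends
\<open>d\<^sub>3\<close> to \<open>-d\<^sub>3 \<noteq> d\<^sub>3\<close>.\<close>

section \<open>The field of algebraic numbers\<close>

lemma ring_of_type_algebra_sel:
  "carrier (ring_of_type_algebra :: 'a::ring_1 ring) = UNIV"
  "monoid.mult (ring_of_type_algebra :: 'a::ring_1 ring) = (*)"
  "one (ring_of_type_algebra :: 'a::ring_1 ring) = 1"
  "ring.zero (ring_of_type_algebra :: 'a::ring_1 ring) = 0"
  "add (ring_of_type_algebra :: 'a::ring_1 ring) = (+)"
  by (simp_all add: ring_of_type_algebra_def fun_eq_iff)

text \<open>The polynomials of \<^theory>\<open>HOL-Algebra.Polynomials\<close> are coefficient lists that start with the leading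
coefficient, whereas \<^const>\<open>Poly\<close> expects the constant coefficient first; hence the reversal. This is the
bridge between the two notions of an algebraic element.\<close>
lemma eval_ring_of_type_algebra:
  "ring.eval (ring_of_type_algebra :: 'a::field ring) ps x = poly (Poly (rev ps)) x"
proof (induction ps)
  interpret R: field "ring_of_type_algebra :: 'a ring" by rule
  have pow: "y [^]\<^bsub>ring_of_type_algebra\<^esub> (n::nat) = y ^ n" for y :: 'a and n
    by (induction n) (simp_all add: ring_of_type_algebra_sel nat_pow_def)
  case Nil
  show ?case by (simp add: ring_of_type_algebra_sel)
  case (Cons a ps)
  then show ?case
    by (simp add: pow Poly_append poly_monom)
       (simp add: ring_of_type_algebra_sel)
qed

lemma subfield_Rats: "subfield \<rat> (ring_of_type_algebra :: 'a::field_char_0 ring)"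
proof -
  interpret R: field "ring_of_type_algebra :: 'a ring" by rule
  let ?R = "ring_of_type_algebra :: 'a ring"
  have minus: "\<ominus>\<^bsub>?R\<^esub> x = - x" for x
    by (rule R.minus_equality) (simp_all add: ring_of_type_algebra_sel)
  have inv: "inv\<^bsub>?R\<^esub> x = inverse x" if "x \<noteq> 0" for x
    by (rule R.inv_char) (use that in \<open>simp_all add: ring_of_type_algebra_sel\<close>)
  show ?thesis
  proof (rule R.subfieldI'[OF R.subringI])
    fix k assume "k \<in> \<rat> - {\<zero>\<^bsub>?R\<^esub>}"
    then have "k \<in> \<rat>" "k \<noteq> 0" by (simp_all add: ring_of_type_algebra_sel)
    then show "inv\<^bsub>?R\<^esub> k \<in> \<rat>" by (simp add: inv)
  qed (simp_all add: minus ring_of_type_algebra_sel)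
qed

lemma algebraic_iff_algebraic_over_Rats:
  fixes x :: "'a::field_char_0"
  shows "algebraic x \<longleftrightarrow> (ring.algebraic ring_of_type_algebra over \<rat>) x"
proof
  let ?R = "ring_of_type_algebra :: 'a ring"
  interpret R: field ?R by rule
  have carrier: "ps \<in> carrier (\<rat> [X]\<^bsub>?R\<^esub>) \<longleftrightarrow> ps = [] \<or> set ps \<subseteq> \<rat> \<and> hd ps \<noteq> 0" for ps
    by (simp add: univ_poly_def polynomial_def ring_of_type_algebra_sel)
  have zero: "\<zero>\<^bsub>?R\<^esub> = 0" by (simp add: ring_of_type_algebra_sel)
  show "(R.algebraic over \<rat>) x" if "algebraic x"
  proof -
    obtain p where p: "\<And>i. Polynomial.coeff p i \<in> \<rat>" "p \<noteq> 0" "poly p x = 0"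
      using \<open>algebraic x\<close> by (auto simp: algebraic_altdef)
    have "set (rev (coeffs p)) \<subseteq> \<rat>" "hd (rev (coeffs p)) \<noteq> 0" "rev (coeffs p) \<noteq> []"
      using p by (auto simp: coeffs_def hd_rev last_map)
    then show ?thesis
      using p by (intro R.algebraicI[of "rev (coeffs p)"])
                 (simp_all add: carrier eval_ring_of_type_algebra zero)
  qed
  show "algebraic x" if alg: "(R.algebraic over \<rat>) x"
  proof -
    have "x \<in> carrier ?R" by (simp add: ring_of_type_algebra_sel)
    then obtain ps where ps: "ps \<in> carrier (\<rat> [X]\<^bsub>?R\<^esub>)" "ps \<noteq> []" "R.eval ps x = \<zero>\<^bsub>?R\<^esub>"
      using R.algebraicE[OF subfieldE(1)[OF subfield_Rats] _ alg] by blast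
    have "set (rev ps) \<subseteq> \<rat>" using ps(1,2) by (simp add: carrier)
    then have "Polynomial.coeff (Poly (rev ps)) i \<in> \<rat>" for i
      by (auto simp del: set_rev simp: nth_default_def dest: nth_mem)
    moreover have "Poly (rev ps) \<noteq> 0"
    proof
      assume "Poly (rev ps) = 0"
      then obtain n where "rev ps = replicate n 0" by (auto simp: Poly_eq_0)
      then have "set ps \<subseteq> {0}" by (metis set_rev set_replicate_conv_if empty_subsetI subset_refl)
      then have "hd ps = 0" using ps(2) by (auto dest: hd_in_set)
      then show False using ps by (simp add: carrier)
    qed
    ultimately show ?thesis
      using ps(3) by (intro algebraicI'[of "Poly (rev ps)"]) (simp_all add: eval_ring_of_type_algebra zero)
  qed
qed

text \<open>Sums and products lie in a finite extension of \<open>\<rat>\<close>; \<open>field.subfield_of_algebraics\<close> is that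
argument for an abstract field.\<close>
lemma algebraic_closed:
  fixes x y :: "'a::field_char_0"
  assumes "algebraic x" "algebraic y"
  shows algebraic_add: "algebraic (x + y)" and algebraic_mult: "algebraic (x * y)"
proof -
  let ?R = "ring_of_type_algebra :: 'a ring"
  interpret R: field ?R by rule
  have *: "subring {x. algebraic x} ?R"
    using subfieldE(1)[OF R.subfield_of_algebraics[OF subfield_Rats]]
    by (simp add: algebraic_iff_algebraic_over_Rats ring_of_type_algebra_sel)
  show "algebraic (x + y)" "algebraic (x * y)"
    using subringE(6,7)[OF *, of x y] assms by (simp_all add: ring_of_type_algebra_sel)
qed
lemma algebraic_diff:
  fixes x y :: "'a::field_char_0"
  shows "algebraic x \<Longrightarrow> algebraic y \<Longrightarrow> algebraic (x - y)"
  using algebraic_add[of x "- y"] by simp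

section \<open>Negation and doubling of points\<close>

fun point_neg :: "'a::field weierstrass \<Rightarrow> 'a point \<Rightarrow> 'a point" where
  "point_neg W Infinity = Infinity"
| "point_neg W (Affine x y) = Affine x (- y - a\<^sub>1 W * x - a\<^sub>3 W)"

lemma point_neg_neg [simp]: "point_neg W (point_neg W P) = P"
  by (cases P) auto

lemma point_neg_eq_Infinity_iff [simp]: "point_neg W P = Infinity \<longleftrightarrow> P = Infinity"
  by (cases P) auto

lemma point_add_Infinity_right [simp]: "point_add W P Infinity = P"
  by (cases P) auto

lemma point_add_eq_Infinity_iff: "point_add W P Q = Infinity \<longleftrightarrow> Q = point_neg W P"
proof -
  have "y1 + y2 + a\<^sub>1 W * x + a\<^sub>3 W = 0 \<longleftrightarrow> y2 = - y1 - a\<^sub>1 W * x - a\<^sub>3 W" for x y1 y2 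
    by (simp add: algebra_simps eq_neg_iff_add_eq_0)
  then show ?thesis
    by (cases P; cases Q) (auto simp: Let_def)
qed

lemma on_curve_neg_iff [simp]: "on_curve W (point_neg W P) \<longleftrightarrow> on_curve W P"
proof (cases P)
  case (Affine x y)
  have "(- y - a\<^sub>1 W * x - a\<^sub>3 W)^2 + a\<^sub>1 W * x * (- y - a\<^sub>1 W * x - a\<^sub>3 W) + a\<^sub>3 W * (- y - a\<^sub>1 W * x - a\<^sub>3 W)
     = y^2 + a\<^sub>1 W * x * y + a\<^sub>3 W * y" by Groebner_Basis.algebra
  with Affine show ?thesis by simp
qed auto

lemma point_neg_Affine_eq_self_iff:
  "point_neg W (Affine x y) = Affine x y \<longleftrightarrow> 2 * y + a\<^sub>1 W * x + a\<^sub>3 W = 0"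
proof -
  have "(- y - a\<^sub>1 W * x - a\<^sub>3 W) - y = - (2 * y + a\<^sub>1 W * x + a\<^sub>3 W)"
    by Groebner_Basis.algebra
  then show ?thesis
    by (metis eq_iff_diff_eq_0 neg_equal_0_iff_equal point.inject point_neg.simps(2))
qed

text \<open>The Weierstrass equation is quadratic in \<open>y\<close>, and the two roots for a given \<open>x\<close> add up to
\<open>-a\<^sub>1x - a\<^sub>3\<close>.\<close>
lemma on_curve_same_x_iff:
  assumes "on_curve W (Affine x y)"
  shows "on_curve W (Affine x z) \<longleftrightarrow> Affine x z \<in> {Affine x y, point_neg W (Affine x y)}"
proof -
  have "on_curve W (Affine x z) \<longleftrightarrow> (z - y) * (z + y + a\<^sub>1 W * x + a\<^sub>3 W) = 0"
    using assms unfolding on_curve.simps by Groebner_Basis.algebra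
  also have "\<dots> \<longleftrightarrow> z = y \<or> z = - y - a\<^sub>1 W * x - a\<^sub>3 W"
  proof -
    have "z + y + a\<^sub>1 W * x + a\<^sub>3 W = z - (- y - a\<^sub>1 W * x - a\<^sub>3 W)"
      by Groebner_Basis.algebra
    then show ?thesis by (simp only: mult_eq_0_iff right_minus_eq)
  qed
  finally show ?thesis by simp
qed

text \<open>The slope \<open>l\<close> of the tangent is characterised by a product rather than a quotient, so that everything
derived from this formula is a polynomial identity.\<close>
lemma point_add_self_eq:
  assumes "2 * y + a\<^sub>1 W * x + a\<^sub>3 W \<noteq> 0"
    and "l * (2 * y + a\<^sub>1 W * x + a\<^sub>3 W) = 3 * x^2 + 2 * a\<^sub>2 W * x + a\<^sub>4 W - a\<^sub>1 W * y"
    and "e = l^2 + a\<^sub>1 W * l - a\<^sub>2 W - x - x"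
  shows "point_add W (Affine x y) (Affine x y) =
    Affine e (- (l * e + (y - l * x)) - a\<^sub>1 W * e - a\<^sub>3 W)"
proof -
  have "l = (3 * x^2 + 2 * a\<^sub>2 W * x + a\<^sub>4 W - a\<^sub>1 W * y) / (2 * y + a\<^sub>1 W * x + a\<^sub>3 W)"
    using assms(1,2) by (simp add: nonzero_eq_divide_eq)
  moreover have "y + y + a\<^sub>1 W * x + a\<^sub>3 W \<noteq> 0" using assms(1) unfolding mult_2 .
  ultimately show ?thesis
    unfolding assms(3) by (simp only: point_add.simps Let_def if_True if_False simp_thms)
qed

text \<open>Negation is a symmetry of the curve: it sends the tangent of slope \<open>l\<close> at a point to the
tangent of slope \<open>-l - a\<^sub>1\<close> at the negative of the point.\<close>
lemma double_neg:
  "point_add W (point_neg W P) (point_neg W P) = point_neg W (point_add W P P)"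
proof (cases P)
  case (Affine x y)
  let ?Y = "2 * y + a\<^sub>1 W * x + a\<^sub>3 W"
  let ?N = "3 * x^2 + 2 * a\<^sub>2 W * x + a\<^sub>4 W - a\<^sub>1 W * y"
  let ?y = "- y - a\<^sub>1 W * x - a\<^sub>3 W"
  show ?thesis
  proof (cases "?Y = 0")
    case True
    then have "point_neg W P = P" unfolding Affine point_neg_Affine_eq_self_iff .
    then show ?thesis
      using point_add_eq_Infinity_iff[of W P P] by simp
  next
    case False
    define l where "l = ?N / ?Y"
    define l' where "l' = - l - a\<^sub>1 W"
    define e where "e = l^2 + a\<^sub>1 W * l - a\<^sub>2 W - x - x"
    have l: "l * ?Y = ?N" using False by (simp add: l_def)
    have Y': "2 * ?y + a\<^sub>1 W * x + a\<^sub>3 W = - ?Y" by Groebner_Basis.algebra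
    have "point_add W (Affine x ?y) (Affine x ?y) =
        Affine e (- (l' * e + (?y - l' * x)) - a\<^sub>1 W * e - a\<^sub>3 W)"
    proof (rule point_add_self_eq)
      show "2 * ?y + a\<^sub>1 W * x + a\<^sub>3 W \<noteq> 0" using False Y' by (metis neg_equal_0_iff_equal)
      show "l' * (2 * ?y + a\<^sub>1 W * x + a\<^sub>3 W) = 3 * x^2 + 2 * a\<^sub>2 W * x + a\<^sub>4 W - a\<^sub>1 W * ?y"
        using l unfolding Y' l'_def by Groebner_Basis.algebra
      show "e = l'^2 + a\<^sub>1 W * l' - a\<^sub>2 W - x - x"
        unfolding e_def l'_def by Groebner_Basis.algebra
    qed
    moreover have "- (l' * e + (?y - l' * x)) - a\<^sub>1 W * e - a\<^sub>3 W
       = - (- (l * e + (y - l * x)) - a\<^sub>1 W * e - a\<^sub>3 W) - a\<^sub>1 W * e - a\<^sub>3 W"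
      unfolding l'_def by Groebner_Basis.algebra
    ultimately show ?thesis
      unfolding Affine point_neg.simps point_add_self_eq[OF False l e_def] by (simp only:)
  qed
qed auto

text \<open>If \<open>P + P = P\<close>, the third point of the tangent at \<open>P\<close> is \<open>-P\<close>, which has the same first coordinate as
\<open>P\<close>. A line with a slope has only one point above each first coordinate, so \<open>P = -P\<close> and
\<open>P + P = O\<close>.\<close>
lemma double_ne_self:
  assumes "P \<noteq> Infinity"
  shows "point_add W P P \<noteq> P"
proof
  assume eq: "point_add W P P = P"
  then have ne: "point_neg W P \<noteq> P"
    using point_add_eq_Infinity_iff[of W P P] assms by auto
  obtain x y where P: "P = Affine x y" using assms by (cases P) auto
  from eq have "point_neg W P = P"
    by (auto simp: P Let_def split: if_splits)
  with ne show False ..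
qed

section \<open>Halving points of order 2\<close>

definition b2 :: "'a::comm_ring_1 weierstrass \<Rightarrow> 'a" where "b2 W = (a\<^sub>1 W)^2 + 4 * a\<^sub>2 W"
definition b4 :: "'a::comm_ring_1 weierstrass \<Rightarrow> 'a" where "b4 W = 2 * a\<^sub>4 W + a\<^sub>1 W * a\<^sub>3 W"
definition b6 :: "'a::comm_ring_1 weierstrass \<Rightarrow> 'a" where "b6 W = (a\<^sub>3 W)^2 + 4 * a\<^sub>6 W"

text \<open>The square of the second division polynomial. At the first coordinate of a point it vanishes if
and only if the point is its own negative.\<close>
definition two_division :: "'a::comm_ring_1 weierstrass \<Rightarrow> 'a \<Rightarrow> 'a" where
  "two_division W x = 4 * x^3 + b2 W * x^2 + 2 * b4 W * x + b6 W"

lemma two_division_on_curve: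
  assumes "on_curve W (Affine x y)"
  shows "two_division W x = (2 * y + a\<^sub>1 W * x + a\<^sub>3 W)^2"
  using assms unfolding two_division_def b2_def b4_def b6_def on_curve.simps by Groebner_Basis.algebra

lemma point_neg_eq_self_iff:
  fixes W :: "'a::field_char_0 weierstrass"
  assumes "on_curve W (Affine x y)"
  shows "point_neg W (Affine x y) = Affine x y \<longleftrightarrow> two_division W x = 0"
  unfolding two_division_on_curve[OF assms] point_neg_Affine_eq_self_iff by simp

text \<open>A quarter of the derivative of \<^const>\<open>two_division\<close> at \<open>e\<close>. For a root \<open>e\<close> it is the value of
\<open>(x - e)\<^sup>2\<close> at the points \<open>(x, y)\<close> whose double is the point of order \<open>2\<close> above \<open>e\<close>.\<close>
definition halving_disc :: "'a::field_char_0 weierstrass \<Rightarrow> 'a \<Rightarrow> 'a" where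
  "halving_disc W e = 3 * e^2 + b2 W / 2 * e + b4 W / 2"

text \<open>Put \<open>Y = 2y + a\<^sub>1x + a\<^sub>3\<close> and \<open>m = 2l + a\<^sub>1\<close>, where \<open>l\<close> is the slope of the tangent at the point; these are
slope and second coordinate after completing the square. The slope formula, the vanishing of the second coordinate
at \<open>(e, f)\<close> and the duplication formula become
\<open>mY = 6x\<^sup>2 + b\<^sub>2x + b\<^sub>4\<close>, \<open>m(e - x) = -Y\<close> and \<open>m\<^sup>2 = 4e + b\<^sub>2 + 8x\<close>. Eliminating \<open>m\<close> and \<open>Y\<close> leaves the
quadratic equation for \<open>x\<close>.\<close>
lemma double_eq_two_torsion:
  fixes W :: "'a::field_char_0 weierstrass"
  assumes "point_add W (Affine x y) (Affine x y) = Affine e f"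
    and "point_neg W (Affine e f) = Affine e f"
  shows "(x - e)^2 = halving_disc W e"
proof -
  define Y where "Y = 2 * y + a\<^sub>1 W * x + a\<^sub>3 W"
  define l where "l = (3 * x^2 + 2 * a\<^sub>2 W * x + a\<^sub>4 W - a\<^sub>1 W * y) / Y"
  have "y + y + a\<^sub>1 W * x + a\<^sub>3 W = Y" by (simp add: Y_def)
  then have "Y \<noteq> 0" using assms(1) by auto
  then have lY: "l * Y = 3 * x^2 + 2 * a\<^sub>2 W * x + a\<^sub>4 W - a\<^sub>1 W * y"
    by (simp add: l_def)
  have e: "e = l^2 + a\<^sub>1 W * l - a\<^sub>2 W - x - x"
    and f: "f = - (l * e + (y - l * x)) - a\<^sub>1 W * e - a\<^sub>3 W"
    using point_add_self_eq[OF \<open>Y \<noteq> 0\<close>[unfolded Y_def] lY[unfolded Y_def] refl]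
    unfolding assms(1) point.inject by simp_all
  have ff: "2 * f + a\<^sub>1 W * e + a\<^sub>3 W = 0"
    using assms(2) unfolding point_neg_Affine_eq_self_iff .
  define m where "m = 2 * l + a\<^sub>1 W"
  have 1: "m * Y = 6 * x^2 + b2 W * x + b4 W"
    using lY unfolding m_def b2_def b4_def Y_def by Groebner_Basis.algebra
  have 2: "m * (e - x) = - Y"
    using ff unfolding f m_def Y_def by Groebner_Basis.algebra
  have 3: "m^2 = 4 * e + b2 W + 8 * x"
    unfolding e m_def b2_def by Groebner_Basis.algebra
  \<comment> \<open>Both sides are \<open>m\<^sup>2(e - x) = -mY\<close>.\<close>
  have "(4 * e + b2 W + 8 * x) * (e - x) = - (6 * x^2 + b2 W * x + b4 W)"
    using 1 2 3 by Groebner_Basis.algebra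
  then have "2 * (x - e)^2 = 6 * e^2 + b2 W * e + b4 W" by Groebner_Basis.algebra
  then show ?thesis by (simp add: halving_disc_def field_simps)
qed

section \<open>The elements of a cyclic subgroup of order 4\<close>

abbreviation base_change :: "rat weierstrass \<Rightarrow> complex weierstrass" where
  "base_change E \<equiv> map_weierstrass of_rat E"

lemma base_change_coeff_rational:
  "a\<^sub>1 (base_change E) \<in> \<rat>" "a\<^sub>2 (base_change E) \<in> \<rat>" "a\<^sub>3 (base_change E) \<in> \<rat>"
  "a\<^sub>4 (base_change E) \<in> \<rat>" "a\<^sub>6 (base_change E) \<in> \<rat>"
  by (simp_all add: weierstrass.map_sel)

lemmas base_change_coeff_algebraic = base_change_coeff_rational[THEN rat_imp_algebraic]

lemma in_Qbar_iff: "z \<in> carrier Qbar \<longleftrightarrow> algebraic z"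
  by (simp add: Qbar_def)

lemma Qbar_points_sel:
  "monoid.mult (Qbar_points E) = point_add (base_change E)" "one (Qbar_points E) = Infinity"
  "P \<in> carrier (Qbar_points E) \<longleftrightarrow> on_curve (base_change E) P \<and> (\<forall>z\<in>set_point P. algebraic z)"
  by (auto simp: Qbar_points_def in_Qbar_iff)

text \<open>The carrier of \<open>G\<close> is left open because inverses are taken both in \<^const>\<open>Qbar_points\<close> and in a
subgroup of it.\<close>
lemma inv_eq_point_neg:
  assumes "monoid.mult G = point_add W" "one G = Infinity"
    and "point_neg W P \<in> carrier G"
  shows "inv\<^bsub>G\<^esub> P = point_neg W P"
  unfolding m_inv_def assms(1,2) point_add_eq_Infinity_iff
  by (rule the_equality) (simp add: assms(3), elim conjE)

lemma subgroup_point_neg: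
  assumes "subgroup S (Qbar_points E)" "P \<in> S"
  shows "point_neg (base_change E) P \<in> S"
proof -
  let ?W = "base_change E"
  have P: "P \<in> carrier (Qbar_points E)" using assms subgroup.subset by blast
  have "\<forall>z\<in>set_point (point_neg ?W P). algebraic z"
  proof (cases P)
    case (Affine x y)
    then have "algebraic x" "algebraic y" using P by (auto simp: Qbar_points_sel)
    then have "algebraic (- y - a\<^sub>1 ?W * x - a\<^sub>3 ?W)"
      by (intro algebraic_diff algebraic_mult algebraic_minus base_change_coeff_algebraic)
    with \<open>algebraic x\<close> show ?thesis by (simp add: Affine)
  qed simp
  with P have "point_neg ?W P \<in> carrier (Qbar_points E)"
    unfolding Qbar_points_sel(3) on_curve_neg_iff by blast
  then have "inv\<^bsub>Qbar_points E\<^esub> P = point_neg ?W P"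
    by (intro inv_eq_point_neg) (simp_all add: Qbar_points_sel)
  with subgroup.m_inv_closed[OF assms] show ?thesis by (simp only:)
qed

text \<open>Generation expressed through closed sets of points only, which makes it possible to exclude a candidate \<open>g\<close> by
exhibiting a set that is closed under addition, contains \<open>O\<close>, \<open>g\<close> and \<open>-g\<close>, and is too small.\<close>
lemma cyclic_subgroup4_generator:
  assumes "cyclic_subgroup4 E C"
  shows "\<exists>g\<in>C. \<forall>S. Infinity \<in> S \<longrightarrow> g \<in> S \<longrightarrow> point_neg (base_change E) g \<in> S \<longrightarrow>
    (\<forall>P\<in>S. \<forall>Q\<in>S. point_add (base_change E) P Q \<in> S) \<longrightarrow> C \<subseteq> S"
proof -
  let ?W = "base_change E" and ?G = "(Qbar_points E)\<lparr>carrier := C\<rparr>"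
  have sub: "subgroup C (Qbar_points E)" and cyc: "cyclic_group ?G"
    using assms by (auto simp: cyclic_subgroup4_def)
  obtain g where g: "g \<in> C" "subgroup_generated ?G {g} = ?G"
    using cyc by (auto simp: cyclic_group_def)
  have C: "C = generate ?G {g}"
    using arg_cong[OF g(2), of carrier] g(1) by (simp add: carrier_subgroup_generated)
  have inv: "inv\<^bsub>?G\<^esub> g = point_neg ?W g"
    using subgroup_point_neg[OF sub g(1)]
    by (intro inv_eq_point_neg) (simp_all add: Qbar_points_sel)
  show ?thesis
  proof (intro bexI[OF _ g(1)] allI impI subsetI)
    fix S P
    assume S: "Infinity \<in> S" "g \<in> S" "point_neg ?W g \<in> S"
      "\<forall>P\<in>S. \<forall>Q\<in>S. point_add ?W P Q \<in> S" and "P \<in> C"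
    have "P \<in> generate ?G {g}" using equalityD1[OF C] \<open>P \<in> C\<close> by (rule subsetD)
    then show "P \<in> S"
      by (induction rule: generate.induct) (use S inv in \<open>auto simp: Qbar_points_sel\<close>)
  qed
qed

text \<open>Negation is an involution of the four-element set that fixes \<open>O\<close>. A generator \<open>g\<close> is not fixed, as
otherwise \<open>{O, g}\<close> would be closed. So \<open>O, g, -g\<close> are distinct, and negation has to fix the
fourth element \<open>T\<close>. The double of \<open>g\<close> is then \<open>T\<close>: it is neither \<open>O\<close> nor \<open>g\<close>, and
if it were \<open>-g\<close>, the set \<open>{O, g, -g}\<close> would be closed.\<close>
lemma cyclic_subgroup4_elements:
  assumes "cyclic_subgroup4 E C"
  obtains P T where "C = {Infinity, T, P, point_neg (base_change E) P}"
    and "P \<noteq> Infinity" "point_neg (base_change E) P \<noteq> P"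
    and "T \<noteq> Infinity" "point_neg (base_change E) T = T"
    and "point_add (base_change E) P P = T"
proof -
  let ?W = "base_change E"
  have sub: "subgroup C (Qbar_points E)" and card: "card C = 4"
    using assms by (auto simp: cyclic_subgroup4_def)
  have O: "Infinity \<in> C" using subgroup.one_closed[OF sub] by (simp add: Qbar_points_sel)
  have neg: "point_neg ?W P \<in> C" if "P \<in> C" for P by (rule subgroup_point_neg[OF sub that])
  have add: "point_add ?W P Q \<in> C" if "P \<in> C" "Q \<in> C" for P Q
    using subgroup.m_closed[OF sub that] by (simp add: Qbar_points_sel)
  obtain g where g: "g \<in> C"
    and gen: "\<forall>S. Infinity \<in> S \<longrightarrow> g \<in> S \<longrightarrow> point_neg ?W g \<in> S \<longrightarrow>
      (\<forall>P\<in>S. \<forall>Q\<in>S. point_add ?W P Q \<in> S) \<longrightarrow> C \<subseteq> S"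
    using cyclic_subgroup4_generator[OF assms] by blast
  have cancel: "point_add ?W P (point_neg ?W P) = Infinity"
      "point_add ?W (point_neg ?W P) P = Infinity" for P
    by (simp_all add: point_add_eq_Infinity_iff)
  have small: "\<not> C \<subseteq> S" if "finite S" "card S < 4" for S
    using card_mono[of S C] that card by auto
  have g_ne: "point_neg ?W g \<noteq> g"
  proof
    assume eq: "point_neg ?W g = g"
    then have "C \<subseteq> {Infinity, g}"
      using cancel[of g] by (intro gen[rule_format]) auto
    then show False using small[of "{Infinity, g}"] card_insert_le_m1[of 2 "{g}" Infinity] by simp
  qed
  then have g_O: "g \<noteq> Infinity" by auto
  then have neg_g_O: "point_neg ?W g \<noteq> Infinity" by simp
  have distinct: "card {Infinity, g, point_neg ?W g} = 3"
    using g_ne[symmetric] g_O[symmetric] neg_g_O[symmetric] by simp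
  then obtain T where T: "T \<in> C" "T \<notin> {Infinity, g, point_neg ?W g}"
    using small[of "{Infinity, g, point_neg ?W g}"] by auto
  have sub4: "insert T {Infinity, g, point_neg ?W g} \<subseteq> C" using O T g neg by auto
  have C: "C = insert T {Infinity, g, point_neg ?W g}"
  proof (rule card_subset_eq[symmetric, OF _ sub4])
    show "finite C" using card by (simp add: card_ge_0_finite)
    show "card (insert T {Infinity, g, point_neg ?W g}) = card C"
      using T(2) distinct card by (subst card_insert_disjoint) simp_all
  qed
  have "point_neg ?W T \<in> insert T {Infinity, g, point_neg ?W g}" using neg[OF T(1)] unfolding C .
  moreover have "point_neg ?W T \<notin> {Infinity, g, point_neg ?W g}"
  proof
    assume "point_neg ?W T \<in> {Infinity, g, point_neg ?W g}"
    then have "point_neg ?W (point_neg ?W T) \<in> {Infinity, point_neg ?W g, point_neg ?W (point_neg ?W g)}"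
      by (elim insertE emptyE) simp_all
    then show False using T(2) by simp
  qed
  ultimately have T_neg: "point_neg ?W T = T" by blast
  have "point_add ?W g g \<noteq> Infinity" using g_ne by (simp add: point_add_eq_Infinity_iff)
  moreover have "point_add ?W g g \<noteq> g" by (rule double_ne_self[OF g_O])
  moreover have "point_add ?W g g \<noteq> point_neg ?W g"
  proof
    assume eq: "point_add ?W g g = point_neg ?W g"
    then have "point_add ?W (point_neg ?W g) (point_neg ?W g) = g"
      by (simp add: double_neg)
    with eq have "C \<subseteq> {Infinity, g, point_neg ?W g}"
      using cancel[of g] by (intro gen[rule_format]) auto
    then show False using T by auto
  qed
  ultimately have "point_add ?W g g = T"
    using add[OF g g] C by blast
  with C g_O g_ne T(2) T_neg show thesis by (intro that[of T g]) (simp_all add: insert_commute)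
qed

section \<open>Cyclic subgroups of order 4 and first coordinates\<close>

definition points_over :: "'a::field weierstrass \<Rightarrow> 'a set \<Rightarrow> 'a point set" where
  "points_over W A = insert Infinity {Affine x y |x y. x \<in> A \<and> on_curve W (Affine x y)}"

lemma Affine_in_points_over_iff [simp]:
  "Affine x y \<in> points_over W A \<longleftrightarrow> x \<in> A \<and> on_curve W (Affine x y)"
  by (auto simp: points_over_def)

lemma Infinity_in_points_over [simp]: "Infinity \<in> points_over W A"
  by (simp add: points_over_def)

text \<open>A subgroup \<open>{O, T, P, -P}\<close> contains all points with the first coordinate \<open>e\<close> of \<open>T\<close> or \<open>x\<close> of
\<open>P\<close>, because two points with the same first coordinate are equal or opposite. So it is determined
by \<open>e\<close> and \<open>x\<close>, which is the form in which the Galois action is read off.\<close>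
lemma cyclic_subgroup4_coordinates:
  assumes "cyclic_subgroup4 E C"
  obtains e x where "C = points_over (base_change E) {e, x}"
    and "two_division (base_change E) e = 0" "two_division (base_change E) x \<noteq> 0"
    and "(x - e)^2 = halving_disc (base_change E) e"
proof -
  let ?W = "base_change E"
  obtain P T where C: "C = {Infinity, T, P, point_neg ?W P}"
    and P: "P \<noteq> Infinity" "point_neg ?W P \<noteq> P"
    and T: "T \<noteq> Infinity" "point_neg ?W T = T" "point_add ?W P P = T"
    using cyclic_subgroup4_elements[OF assms] by metis
  obtain x y e f where xy: "P = Affine x y" and ef: "T = Affine e f"
    using P(1) T(1) by (cases P; cases T) auto
  have "P \<in> carrier (Qbar_points E)" "T \<in> carrier (Qbar_points E)"
    using assms C subgroup.subset unfolding cyclic_subgroup4_def by blast+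
  then have on: "on_curve ?W (Affine x y)" "on_curve ?W (Affine e f)"
    by (auto simp: Qbar_points_sel xy ef simp del: on_curve.simps)
  obtain y' where y': "point_neg ?W P = Affine x y'" by (simp add: xy)
  have "C = points_over ?W {e, x}"
  proof (intro equalityI subsetI)
    fix Q assume "Q \<in> C"
    moreover have "on_curve ?W (point_neg ?W P)"
      using on(1) unfolding on_curve_neg_iff xy .
    ultimately show "Q \<in> points_over ?W {e, x}"
      using on y' unfolding C xy ef by (auto simp del: on_curve.simps point_neg.simps)
  next
    fix Q assume Q: "Q \<in> points_over ?W {e, x}"
    show "Q \<in> C"
    proof (cases Q)
      case (Affine a b)
      with Q have ab: "a = e \<or> a = x" "on_curve ?W (Affine a b)" by simp_all
      from ab(1) show ?thesis
      proof
        assume "a = e"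
        then have "Affine a b \<in> {T, point_neg ?W T}"
          using on_curve_same_x_iff[OF on(2)] ab(2) unfolding ef by blast
        then show ?thesis using T(2) unfolding C Affine by simp
      next
        assume "a = x"
        then have "Affine a b \<in> {P, point_neg ?W P}"
          using on_curve_same_x_iff[OF on(1)] ab(2) unfolding xy by blast
        then show ?thesis unfolding C Affine by blast
      qed
    qed (simp add: C)
  qed
  moreover have "two_division ?W e = 0" "two_division ?W x \<noteq> 0"
    using point_neg_eq_self_iff[OF on(1)] point_neg_eq_self_iff[OF on(2)] P T by (auto simp: xy ef)
  moreover have "(x - e)^2 = halving_disc ?W e"
    using T double_eq_two_torsion[of ?W x y e f] by (auto simp: xy ef)
  ultimately show thesis by (rule that)
qed

lemma subgroup_card2:
  assumes "subgroup T (Qbar_points E)" "card T = 2"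
  obtains e f where "Affine e f \<in> T" "two_division (base_change E) e = 0"
proof -
  let ?W = "base_change E"
  have O: "Infinity \<in> T" using subgroup.one_closed[OF assms(1)] by (simp add: Qbar_points_sel)
  with assms(2) obtain t where t: "T = {Infinity, t}" "t \<noteq> Infinity"
    by (metis card_2_iff insertE insert_commute singletonD)
  have "point_neg ?W t = t" using subgroup_point_neg[OF assms(1), of t] t by auto
  moreover obtain e f where "t = Affine e f" using t(2) by (cases t) auto
  moreover have "on_curve ?W t"
    using subgroup.subset[OF assms(1)] t by (auto simp: Qbar_points_sel)
  ultimately show thesis using t by (intro that[of e f]) (auto simp: point_neg_eq_self_iff simp del: on_curve.simps point_neg.simps)
qed

text \<open>Both members contain the same point of order \<open>2\<close> and so have the same \<open>e\<close>. Their other coordinates differ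
from \<open>e\<close> by the two square roots of the same number, hence are of the form \<open>e + d\<close> and \<open>e - d\<close> with \<open>d \<noteq> 0\<close>.\<close>
lemma cyclic4_pair_halving:
  assumes "cyclic4_pair E p"
  obtains e d where "two_division (base_change E) e = 0"
    and "d \<noteq> 0" "d^2 = halving_disc (base_change E) e"
    and "p = {points_over (base_change E) {e, e + d}, points_over (base_change E) {e, e - d}}"
    and "two_division (base_change E) (e + d) \<noteq> 0" "two_division (base_change E) (e - d) \<noteq> 0"
proof -
  let ?W = "base_change E"
  obtain C D T where p: "p = {C, D}" "C \<noteq> D"
    and CD: "cyclic_subgroup4 E C" "cyclic_subgroup4 E D"
    and T: "subgroup T (Qbar_points E)" "card T = 2" "T \<subseteq> C" "T \<subseteq> D"
    using assms unfolding cyclic4_pair_def by (elim exE conjE) (rule that)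
  obtain e f where ef: "Affine e f \<in> T" "two_division ?W e = 0"
    using subgroup_card2[OF T(1,2)] .
  have coord: "\<exists>x. S = points_over ?W {e, x} \<and> two_division ?W x \<noteq> 0 \<and> (x - e)^2 = halving_disc ?W e"
    if S: "cyclic_subgroup4 E S" "T \<subseteq> S" for S
  proof -
    obtain e' x where *: "S = points_over ?W {e', x}" "two_division ?W x \<noteq> 0"
        "(x - e')^2 = halving_disc ?W e'"
      using cyclic_subgroup4_coordinates[OF S(1)] by metis
    \<comment> \<open>The point above \<open>e\<close> in \<open>T\<close> lies in \<open>S\<close>, and \<open>e = x\<close> is impossible because only \<open>e\<close> is a root.\<close>
    moreover have "e' = e"
      using ef * S(2) by (auto simp del: on_curve.simps)
    ultimately show ?thesis by blast
  qed
  obtain x where x: "C = points_over ?W {e, x}" "two_division ?W x \<noteq> 0" "(x - e)^2 = halving_disc ?W e"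
    using coord[OF CD(1) T(3)] by blast
  obtain x' where x': "D = points_over ?W {e, x'}" "two_division ?W x' \<noteq> 0" "(x' - e)^2 = halving_disc ?W e"
    using coord[OF CD(2) T(4)] by blast
  have "x' - e = - (x - e)"
    using x x' p(2) by (metis diff_add_cancel power2_eq_iff)
  then have "x = e + (x - e)" "x' = e - (x - e)" by (simp_all add: algebra_simps)
  with x x' p ef(2) show thesis
    by (intro that[of e "x - e"]) auto
qed

section \<open>The Galois action on points\<close>

lemma GalD:
  assumes "\<sigma> \<in> Gal K"
  shows Gal_add: "algebraic x \<Longrightarrow> algebraic y \<Longrightarrow> \<sigma> (x + y) = \<sigma> x + \<sigma> y"
    and Gal_mult: "algebraic x \<Longrightarrow> algebraic y \<Longrightarrow> \<sigma> (x * y) = \<sigma> x * \<sigma> y"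
    and Gal_fixes: "x \<in> K \<Longrightarrow> \<sigma> x = x"
    and Gal_inj_on: "inj_on \<sigma> {z. algebraic z}"
  using assms
  by (auto simp: Gal_def ring_iso_def ring_hom_def Qbar_def ring_of_type_algebra_sel bij_betw_def)

lemma Gal_diff:
  assumes "\<sigma> \<in> Gal K" "algebraic x" "algebraic y"
  shows "\<sigma> (x - y) = \<sigma> x - \<sigma> y"
  using Gal_add[OF assms(1) algebraic_diff[OF assms(2,3)] assms(3)] by (simp add: algebra_simps)

text \<open>Only rational coefficients, sums and products occur on the right, so the equation can be pushed
through any automorphism of \<^const>\<open>Qbar\<close>.\<close>
lemma two_division_base_change_eq:
  "\<exists>b2\<in>\<rat>. \<exists>b4\<in>\<rat>. \<exists>b6\<in>\<rat>. \<forall>x. two_division (base_change E) x = 4 * (x * (x * x)) + (b2 * (x * x) + (b4 * x + b6))"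
proof (intro bexI allI)
  let ?W = "base_change E"
  show "two_division ?W x = 4 * (x * (x * x)) + (b2 ?W * (x * x) + (2 * b4 ?W * x + b6 ?W))" for x
    unfolding two_division_def by Groebner_Basis.algebra
qed (simp_all add: b2_def b4_def b6_def base_change_coeff_rational)

lemma Gal_two_division:
  assumes "\<sigma> \<in> Gal K" "\<rat> \<subseteq> K" "algebraic x"
  shows "\<sigma> (two_division (base_change E) x) = two_division (base_change E) (\<sigma> x)"
proof -
  obtain b2 b4 b6 where b: "b2 \<in> \<rat>" "b4 \<in> \<rat>" "b6 \<in> \<rat>"
    and eq: "\<And>x. two_division (base_change E) x = 4 * (x * (x * x)) + (b2 * (x * x) + (b4 * x + b6))"
    using two_division_base_change_eq[of E] by metis
  have fix_rat: "\<sigma> q = q" if "q \<in> \<rat>" for q using Gal_fixes[OF assms(1)] assms(2) that by blast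
  have alg: "algebraic b2" "algebraic b4" "algebraic b6" "algebraic (4::complex)"
    using b by (auto intro: rat_imp_algebraic)
  show ?thesis
    unfolding eq
    using assms(3) alg fix_rat[OF b(1)] fix_rat[OF b(2)] fix_rat[OF b(3)] fix_rat[of 4]
    by (simp add: Gal_add[OF assms(1)] Gal_mult[OF assms(1)] algebraic_add algebraic_mult)
qed

lemma Gal_on_curve:
  assumes "\<sigma> \<in> Gal K" "\<rat> \<subseteq> K" "P \<in> carrier (Qbar_points E)"
  shows "on_curve (base_change E) (map_point \<sigma> P)"
proof (cases P)
  case (Affine x y)
  let ?W = "base_change E"
  have alg: "algebraic x" "algebraic y" using assms(3) by (auto simp: Affine Qbar_points_sel)
  have "y * y + (a\<^sub>1 ?W * (x * y) + a\<^sub>3 ?W * y) = x * (x * x) + (a\<^sub>2 ?W * (x * x) + (a\<^sub>4 ?W * x + a\<^sub>6 ?W))"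
    using assms(3) unfolding Affine Qbar_points_sel on_curve.simps
    by (simp add: power2_eq_square power3_eq_cube algebra_simps)
  from arg_cong[OF this, of \<sigma>]
  have "\<sigma> y * \<sigma> y + (a\<^sub>1 ?W * (\<sigma> x * \<sigma> y) + a\<^sub>3 ?W * \<sigma> y)
      = \<sigma> x * (\<sigma> x * \<sigma> x) + (a\<^sub>2 ?W * (\<sigma> x * \<sigma> x) + (a\<^sub>4 ?W * \<sigma> x + a\<^sub>6 ?W))"
    using alg base_change_coeff_rational[of E, THEN subsetD[OF assms(2)], THEN Gal_fixes[OF assms(1)]]
    by (simp add: Gal_add[OF assms(1)] Gal_mult[OF assms(1)] algebraic_add algebraic_mult
        base_change_coeff_algebraic del: weierstrass.map_sel)
  then show ?thesis
    unfolding Affine by (simp add: power2_eq_square power3_eq_cube algebra_simps)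
qed simp

lemma on_curve_exists_y: "\<exists>y. on_curve W (Affine (x :: complex) y)"
proof
  define r where "r = csqrt (two_division W x)"
  have "r^2 = 4 * x^3 + ((a\<^sub>1 W)^2 + 4 * a\<^sub>2 W) * x^2 + 2 * (2 * a\<^sub>4 W + a\<^sub>1 W * a\<^sub>3 W) * x + ((a\<^sub>3 W)^2 + 4 * a\<^sub>6 W)"
    by (simp add: r_def two_division_def b2_def b4_def b6_def)
  moreover define y where "y = (r - a\<^sub>1 W * x - a\<^sub>3 W) / 2"
  then have "r = 2 * y + a\<^sub>1 W * x + a\<^sub>3 W" by (simp add: field_simps)
  ultimately have "4 * (y^2 + a\<^sub>1 W * x * y + a\<^sub>3 W * y) = 4 * (x^3 + a\<^sub>2 W * x^2 + a\<^sub>4 W * x + a\<^sub>6 W)"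
    by Groebner_Basis.algebra
  then show "on_curve W (Affine x ((r - a\<^sub>1 W * x - a\<^sub>3 W) / 2))"
    unfolding y_def[symmetric] on_curve.simps by (rule mult_left_cancel[THEN iffD1, rotated]) simp
qed

text \<open>Over \<open>\<complex>\<close> there is a point above every first coordinate; if all points above \<open>x\<close> belong to a subgroup of
\<^const>\<open>Qbar_points\<close>, then \<open>x\<close> is algebraic.\<close>
lemma cyclic_subgroup4_algebraic:
  assumes "cyclic_subgroup4 E (points_over (base_change E) A)" "x \<in> A"
  shows "algebraic x"
proof -
  obtain y where "on_curve (base_change E) (Affine x y)" using on_curve_exists_y by blast
  then have "Affine x y \<in> carrier (Qbar_points E)"
    using assms subgroup.subset[of _ "Qbar_points E"] unfolding cyclic_subgroup4_def by fastforce
  then show ?thesis by (simp add: Qbar_points_sel)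
qed

text \<open>An automorphism that stabilises the subgroup permutes the first coordinates \<open>e\<close> and \<open>x\<close>. Only
\<open>e\<close> is a root of \<^const>\<open>two_division\<close>, whose coefficients are rational, so the permutation is trivial.
Conversely, fixing \<open>e\<close> and \<open>x\<close> preserves the set of all points above them, and an injective self-map of
a finite set is onto.\<close>
lemma defined_over_iff_fixes_coordinates:
  assumes C: "cyclic_subgroup4 E (points_over (base_change E) {e, x})"
    and e: "two_division (base_change E) e = 0" and x: "two_division (base_change E) x \<noteq> 0"
    and K: "\<rat> \<subseteq> K"
  shows "defined_over K (points_over (base_change E) {e, x}) \<longleftrightarrow> (\<forall>\<sigma>\<in>Gal K. \<sigma> e = e \<and> \<sigma> x = x)"
proof -
  let ?W = "base_change E" and ?C = "points_over (base_change E) {e, x}"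
  have alg: "algebraic e" "algebraic x" using cyclic_subgroup4_algebraic[OF C] by auto
  have sub: "?C \<subseteq> carrier (Qbar_points E)"
    using C subgroup.subset unfolding cyclic_subgroup4_def by blast
  have "map_point \<sigma> ` ?C = ?C \<longleftrightarrow> \<sigma> e = e \<and> \<sigma> x = x" if \<sigma>: "\<sigma> \<in> Gal K" for \<sigma>
  proof
    assume stable: "map_point \<sigma> ` ?C = ?C"
    have moved: "\<sigma> z \<in> {e, x}" if "z \<in> {e, x}" for z
    proof -
      obtain y where "on_curve ?W (Affine z y)" using on_curve_exists_y by blast
      with that have "Affine z y \<in> ?C" by simp
      then have "map_point \<sigma> (Affine z y) \<in> ?C" using stable by blast
      then show ?thesis by simp
    qed
    have "\<sigma> 0 = 0" using Gal_fixes[OF \<sigma>] K by auto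
    then have "two_division ?W (\<sigma> e) = 0"
      using Gal_two_division[OF \<sigma> K alg(1), of E] e by simp
    moreover have "two_division ?W (\<sigma> x) \<noteq> 0"
    proof
      assume "two_division ?W (\<sigma> x) = 0"
      then have "\<sigma> (two_division ?W x) = \<sigma> 0"
        using Gal_two_division[OF \<sigma> K alg(2), of E] \<open>\<sigma> 0 = 0\<close> by simp
      moreover have "algebraic (two_division ?W x)"
      proof -
        obtain b2 b4 b6 where "b2 \<in> \<rat>" "b4 \<in> \<rat>" "b6 \<in> \<rat>"
          "two_division (base_change E) x = 4 * (x * (x * x)) + (b2 * (x * x) + (b4 * x + b6))"
          using two_division_base_change_eq[of E] by metis
        then show ?thesis
          using alg(2) by (auto intro!: algebraic_add algebraic_mult intro: rat_imp_algebraic)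
      qed
      ultimately have "two_division ?W x = 0"
        using inj_onD[OF Gal_inj_on[OF \<sigma>]] by auto
      with x show False ..
    qed
    ultimately show "\<sigma> e = e \<and> \<sigma> x = x"
      using moved[of e] moved[of x] e x by auto
  next
    assume fixed: "\<sigma> e = e \<and> \<sigma> x = x"
    have "map_point \<sigma> ` ?C \<subseteq> ?C"
    proof
      fix Q assume "Q \<in> map_point \<sigma> ` ?C"
      then obtain P where P: "P \<in> ?C" "Q = map_point \<sigma> P" by blast
      then have "on_curve ?W (map_point \<sigma> P)" using Gal_on_curve[OF \<sigma> K] sub by blast
      then show "Q \<in> ?C"
        using P fixed by (cases P) (auto simp del: on_curve.simps)
    qed
    moreover have "inj_on (map_point \<sigma>) ?C"
    proof (rule inj_onI)
      fix P Q assume "P \<in> ?C" "Q \<in> ?C" and eq: "map_point \<sigma> P = map_point \<sigma> Q"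
      then have "P \<in> carrier (Qbar_points E)" "Q \<in> carrier (Qbar_points E)" using sub by auto
      then show "P = Q"
        using eq Gal_inj_on[OF \<sigma>]
        by (cases P; cases Q) (auto simp: Qbar_points_sel inj_on_def simp del: on_curve.simps)
    qed
    moreover have "finite ?C"
      using C by (auto simp: cyclic_subgroup4_def intro: card_ge_0_finite)
    ultimately show "map_point \<sigma> ` ?C = ?C" by (simp add: endo_inj_surj)
  qed
  then show ?thesis by (simp add: defined_over_def)
qed

section \<open>The third pair\<close>

text \<open>For both members of a pair the field of definition is governed by the same two numbers \<open>e\<close> and \<open>d\<close>.\<close>
lemma cyclic4_pair_coordinates:
  assumes "cyclic4_pair E p"
  obtains e d where "two_division (base_change E) e = 0" "d \<noteq> 0" "d^2 = halving_disc (base_change E) e"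
    and "p = {points_over (base_change E) {e, e + d}, points_over (base_change E) {e, e - d}}"
    and "algebraic e" "algebraic d"
    and "\<forall>C\<in>p. \<forall>K. \<rat> \<subseteq> K \<longrightarrow> (defined_over K C \<longleftrightarrow> (\<forall>\<sigma>\<in>Gal K. \<sigma> e = e \<and> \<sigma> d = d))"
proof -
  let ?W = "base_change E"
  obtain e d where ed: "two_division ?W e = 0" "d \<noteq> 0" "d^2 = halving_disc ?W e"
    and p: "p = {points_over ?W {e, e + d}, points_over ?W {e, e - d}}"
    and x: "two_division ?W (e + d) \<noteq> 0" "two_division ?W (e - d) \<noteq> 0"
    using cyclic4_pair_halving[OF assms] .
  have cyc: "cyclic_subgroup4 E C" if "C \<in> p" for C
    using assms that unfolding cyclic4_pair_def by blast
  then have cyc2: "cyclic_subgroup4 E (points_over ?W {e, e + d})" "cyclic_subgroup4 E (points_over ?W {e, e - d})"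
    using p by auto
  have e: "algebraic e" and ed_alg: "algebraic (e + d)"
    using cyclic_subgroup4_algebraic[OF cyc2(1)] by auto
  have d: "algebraic d" using algebraic_diff[OF ed_alg e] by simp
  have "defined_over K C \<longleftrightarrow> (\<forall>\<sigma>\<in>Gal K. \<sigma> e = e \<and> \<sigma> d = d)" if "C \<in> p" "\<rat> \<subseteq> K" for C K
  proof -
    have plus: "\<sigma> (e + d) = \<sigma> e + \<sigma> d" and minus: "\<sigma> (e - d) = \<sigma> e - \<sigma> d" if "\<sigma> \<in> Gal K" for \<sigma>
      by (rule Gal_add[OF that e d], rule Gal_diff[OF that e d])
    from \<open>C \<in> p\<close> p consider "C = points_over ?W {e, e + d}" | "C = points_over ?W {e, e - d}" by blast
    then show ?thesis
      by cases (simp_all add: defined_over_iff_fixes_coordinates[OF _ ed(1) _ \<open>\<rat> \<subseteq> K\<close>] cyc2 x plus minus cong: conj_cong)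
  qed
  with ed p e d show thesis by (intro that[of e d]) blast+
qed

text \<open>Divided differences replace the factorisation of the cubic: dividing the difference of the values at two roots by
the difference of the roots, and repeating this once, yields the elementary symmetric relations.\<close>
lemma two_division_roots:
  fixes W :: "'a::field_char_0 weierstrass"
  assumes "two_division W e1 = 0" "two_division W e2 = 0" "two_division W e3 = 0"
    and "e1 \<noteq> e2" "e1 \<noteq> e3" "e2 \<noteq> e3"
  shows "4 * (e1 + e2 + e3) = - b2 W"
    and "halving_disc W e1 = (e1 - e2) * (e1 - e3)"
proof -
  have "(e1 - e2) * (4 * (e1^2 + e1 * e2 + e2^2) + b2 W * (e1 + e2) + 2 * b4 W) = 0"
    using assms(1,2) unfolding two_division_def by Groebner_Basis.algebra
  then have 12: "4 * (e1^2 + e1 * e2 + e2^2) + b2 W * (e1 + e2) + 2 * b4 W = 0"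
    using assms(4) by simp
  have "(e1 - e3) * (4 * (e1^2 + e1 * e3 + e3^2) + b2 W * (e1 + e3) + 2 * b4 W) = 0"
    using assms(1,3) unfolding two_division_def by Groebner_Basis.algebra
  then have 13: "4 * (e1^2 + e1 * e3 + e3^2) + b2 W * (e1 + e3) + 2 * b4 W = 0"
    using assms(5) by simp
  have "(e2 - e3) * (4 * (e1 + e2 + e3) + b2 W) = 0"
    using 12 13 by Groebner_Basis.algebra
  then have sum: "4 * (e1 + e2 + e3) + b2 W = 0" using assms(6) by simp
  then show "4 * (e1 + e2 + e3) = - b2 W" by (simp add: eq_neg_iff_add_eq_0)
  have "4 * (3 * e1^2) + 2 * b2 W * e1 + 2 * b4 W = 4 * ((e1 - e2) * (e1 - e3))"
    using 12 sum by Groebner_Basis.algebra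
  then have "4 * halving_disc W e1 = 4 * ((e1 - e2) * (e1 - e3))"
    by (simp add: halving_disc_def algebra_simps)
  then show "halving_disc W e1 = (e1 - e2) * (e1 - e3)"
    by (rule mult_left_cancel[THEN iffD1, rotated]) simp
qed

lemma cnj_in_Gal: "cnj \<in> Gal \<rat>"
proof -
  have "cnj q = q" if "q \<in> \<rat>" for q
    using that by (metis Rats_cases' complex_cnj_divide complex_cnj_of_int)
  moreover have "bij_betw cnj {z. algebraic z} {z. algebraic z}"
    by (rule bij_betwI[where g = cnj]) (auto simp: algebraic_cnj)
  ultimately show ?thesis
    by (auto simp: Gal_def ring_iso_def ring_hom_def Qbar_def ring_of_type_algebra_sel)
qed

lemma Q_i_contains: "\<rat> \<subseteq> Q_i" "\<i> \<in> Q_i"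
  by (auto simp: Q_i_def intro: generate_field.incl)

theorem corollary3p5:
  fixes E :: "rat weierstrass" and p1 p2 p3 :: "complex point set set" and C :: "complex point set"
  assumes "elliptic_curve E"
    and "galois_stable_pair E p1" and "galois_stable_pair E p2" and "p1 \<noteq> p2"
    and "cyclic4_pair E p3" and "p3 \<noteq> p1" and "p3 \<noteq> p2"
    and "C \<in> p3"
  shows "defined_over Q_i C \<and> \<not> defined_over \<rat> C"
proof -
  let ?W = "base_change E"
  have pairs: "cyclic4_pair E p1" "cyclic4_pair E p2"
    and stable: "\<And>C. C \<in> p1 \<union> p2 \<Longrightarrow> defined_over \<rat> C"
    using assms(2,3) by (auto simp: galois_stable_pair_def galois_stable_def)
  obtain e1 d1 where e1: "two_division ?W e1 = 0" "d1 \<noteq> 0" "d1^2 = halving_disc ?W e1"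
    and p1: "p1 = {points_over ?W {e1, e1 + d1}, points_over ?W {e1, e1 - d1}}"
    and alg1: "algebraic e1" "algebraic d1"
    and def1: "\<forall>C\<in>p1. \<forall>K. \<rat> \<subseteq> K \<longrightarrow> (defined_over K C \<longleftrightarrow> (\<forall>\<sigma>\<in>Gal K. \<sigma> e1 = e1 \<and> \<sigma> d1 = d1))"
    using cyclic4_pair_coordinates[OF pairs(1)] .
  obtain e2 d2 where e2: "two_division ?W e2 = 0" "d2 \<noteq> 0" "d2^2 = halving_disc ?W e2"
    and p2: "p2 = {points_over ?W {e2, e2 + d2}, points_over ?W {e2, e2 - d2}}"
    and alg2: "algebraic e2" "algebraic d2"
    and def2: "\<forall>C\<in>p2. \<forall>K. \<rat> \<subseteq> K \<longrightarrow> (defined_over K C \<longleftrightarrow> (\<forall>\<sigma>\<in>Gal K. \<sigma> e2 = e2 \<and> \<sigma> d2 = d2))"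
    using cyclic4_pair_coordinates[OF pairs(2)] .
  obtain e3 d3 where e3: "two_division ?W e3 = 0" "d3 \<noteq> 0" "d3^2 = halving_disc ?W e3"
    and p3: "p3 = {points_over ?W {e3, e3 + d3}, points_over ?W {e3, e3 - d3}}"
    and alg3: "algebraic e3" "algebraic d3"
    and def3: "\<forall>C\<in>p3. \<forall>K. \<rat> \<subseteq> K \<longrightarrow> (defined_over K C \<longleftrightarrow> (\<forall>\<sigma>\<in>Gal K. \<sigma> e3 = e3 \<and> \<sigma> d3 = d3))"
    using cyclic4_pair_coordinates[OF assms(5)] .

  \<comment> \<open>A root \<open>e\<close> determines \<open>d\<close> up to sign and hence the pair, so distinct pairs have distinct roots.\<close>
  have same: "{points_over ?W {e, e + d}, points_over ?W {e, e - d}} =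
      {points_over ?W {e, e + d'}, points_over ?W {e, e - d'}}"
    if "d^2 = halving_disc ?W e" "d'^2 = halving_disc ?W e" for e d d'
  proof -
    have "d = d' \<or> d = - d'" using that by (metis power2_eq_iff)
    then show ?thesis by (elim disjE) (simp_all add: insert_commute)
  qed
  have distinct: "e1 \<noteq> e2" "e1 \<noteq> e3" "e2 \<noteq> e3"
    using same e1(3) e2(3) e3(3) p1 p2 p3 assms(4,6,7) by metis+

  have sum: "4 * (e1 + e2 + e3) = - b2 ?W"
    by (rule two_division_roots(1)[OF e1(1) e2(1) e3(1) distinct])
  have disc1: "d1^2 = (e1 - e2) * (e1 - e3)"
    using two_division_roots(2)[OF e1(1) e2(1) e3(1) distinct] e1(3) by simp
  have disc2: "d2^2 = (e2 - e1) * (e2 - e3)"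
    using two_division_roots(2)[OF e2(1) e1(1) e3(1)] distinct e2(3) by metis
  have disc3: "d3^2 = (e3 - e1) * (e3 - e2)"
    using two_division_roots(2)[OF e3(1) e1(1) e2(1)] distinct e3(3) by metis
  define v where "v = (e1 - e2) * (e1 - e3) * (e2 - e3)"
  have "(d1 * d2 * d3)^2 = - (v^2)"
    unfolding v_def power_mult_distrib disc1 disc2 disc3 by Groebner_Basis.algebra
  then have "(d1 * d2 * d3)^2 = (\<i> * v)^2" by (simp add: power_mult_distrib)
  then have "d1 * d2 * d3 = \<i> * v \<or> d1 * d2 * d3 = - (\<i> * v)"
    unfolding power2_eq_iff .
  then obtain s where s: "s = 1 \<or> s = -1" and prod: "d1 * d2 * d3 = s * (\<i> * v)"
  proof (elim disjE)
    assume "d1 * d2 * d3 = \<i> * v" then show thesis by (intro that[of 1]) simp_all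
  next
    assume "d1 * d2 * d3 = - (\<i> * v)" then show thesis by (intro that[of "-1"]) simp_all
  qed

  \<comment> \<open>The sign \<open>s\<close> and \<open>v\<close> are fixed, so \<open>\<sigma>\<close> acts on \<open>d\<^sub>1d\<^sub>2d\<^sub>3\<close>, and thus on \<open>d\<^sub>3\<close>, as it does on \<open>\<i>\<close>.\<close>
  have action: "\<sigma> e3 = e3 \<and> d1 * d2 * \<sigma> d3 = \<sigma> \<i> * (s * v)" if \<sigma>: "\<sigma> \<in> Gal \<rat>" for \<sigma>
  proof -
    have "points_over ?W {e1, e1 + d1} \<in> p1" "points_over ?W {e2, e2 + d2} \<in> p2"
      unfolding p1 p2 by blast+
    then have fix12: "\<sigma> e1 = e1" "\<sigma> d1 = d1" "\<sigma> e2 = e2" "\<sigma> d2 = d2"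
      using def1 def2 stable \<sigma> by (meson UnI1 UnI2 subset_refl)+
    have rat: "- b2 ?W / 4 \<in> \<rat>" by (simp add: b2_def base_change_coeff_rational)
    have "e3 + (e1 + e2) = - b2 ?W / 4" using sum by (simp add: field_simps)
    then have "\<sigma> (e3 + (e1 + e2)) = e3 + (e1 + e2)" using Gal_fixes[OF \<sigma> rat] by simp
    then have fix3: "\<sigma> e3 = e3"
      using fix12 alg1 alg2 alg3 by (simp add: Gal_add[OF \<sigma>] algebraic_add)
    have "s \<in> \<rat>" using s by auto
    then have s_fix: "\<sigma> s = s" "algebraic s" by (auto intro: Gal_fixes[OF \<sigma>] rat_imp_algebraic)
    have v_fix: "\<sigma> v = v" "algebraic v"
      using fix12 fix3 alg1 alg2 alg3 unfolding v_def
      by (simp_all add: Gal_mult[OF \<sigma>] Gal_diff[OF \<sigma>] algebraic_mult algebraic_diff)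
    have "\<sigma> (d1 * d2 * d3) = \<sigma> (\<i> * (s * v))" unfolding prod by (simp add: mult_ac)
    then have "d1 * d2 * \<sigma> d3 = \<sigma> \<i> * (s * v)"
      using fix12 s_fix v_fix alg1 alg2 alg3 by (simp add: Gal_mult[OF \<sigma>] algebraic_mult)
    with fix3 show ?thesis ..
  qed

  have "\<sigma> e3 = e3 \<and> \<sigma> d3 = d3" if "\<sigma> \<in> Gal Q_i" for \<sigma>
  proof -
    have "\<sigma> \<in> Gal \<rat>" using that Q_i_contains(1) by (auto simp: Gal_def)
    moreover have "\<sigma> \<i> = \<i>" by (rule Gal_fixes[OF that Q_i_contains(2)])
    ultimately have "\<sigma> e3 = e3" "d1 * d2 * \<sigma> d3 = d1 * d2 * d3"
      using action[of \<sigma>] prod by (simp_all add: mult_ac)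
    then show ?thesis using e1(2) e2(2) by simp
  qed
  moreover have "cnj d3 \<noteq> d3"
  proof
    assume "cnj d3 = d3"
    then have "d1 * d2 * d3 = - (d1 * d2 * d3)"
      using action[OF cnj_in_Gal] prod by (simp add: mult_ac)
    then show False using e1(2) e2(2) e3(2) by simp
  qed
  ultimately show ?thesis
    using def3 assms(8) Q_i_contains(1) cnj_in_Gal by blast
qed

end
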